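(* Fix an integer $k\ge 2$, an integer $J\ge 0$ and $i\in\{1,\dots,k\}$, and let $B_r$ and the polynomials $h^{(j)}_{i,l}(q)$ ($j\ge J$, $l\in\{1,\dots,k\}$) be as in the context. If $k$ is odd, let $\bar{i}\in\{1,2\}$ with $\bar i\equiv i\pmod 2$; then the sequence $\big(h^{(j)}_{i,\bar i}(q)\big)_{j\ge J}$ has a limit $h^{(\infty)}_i(q)$ as $j\to\infty$. If $k$ is even, for each $j\ge J$ let $\overline{j-J+i}\in\{1,2\}$ with $\overline{j-J+i}\equiv j-J+i\pmod 2$; then the sequence $\big(h^{(j)}_{i,\overline{j-J+i}}(q)\big)_{j\ge J}$ has a limit $h^{(\infty)}_i(q)$ as $j\to\infty$. In either case, \[ B_{(k-1)J+i}=h^{(\infty)}_i(q). \]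
   Context: $q$ is a formal variable and all series lie in $\mathbb{C}((q))$. Write $(q)_\infty=\prod_{s\ge1}(1-q^s)$. Fix $k\ge 2$. For $i\in\{1,\dots,k\}$ set $B_i=\prod_{m\ge 1}(1-q^{2km})(1-q^{2km-k+i-1})(1-q^{2km-k-i+1})/(q)_\infty$. Recursively, for each $j\ge 0$, given $B_{(k-1)j+1},\dots,B_{(k-1)j+k}$, define ghost series $\tilde{B}_{(k-1)j+i}=(B_{(k-1)j+i-1}+q^{j+1}B_{(k-1)j+i+1})/(1+q^{j+1})$ for $i\in\{2,\dots,k-1\}$ and $\tilde{B}_{(k-1)j+k}=B_{(k-1)j+k-1}/(1+q^{j+1})$; then $B_{(k-1)(j+1)+1}$ is the already defined $B_{(k-1)j+k}$, $B_{(k-1)(j+1)+2}=(B_{(k-1)j+k-1}-\tilde{B}_{(k-1)j+k})/q^{j+1}$, and $B_{(k-1)(j+1)+i}=(B_{(k-1)j+k-i+1}-\tilde{B}_{(k-1)j+k-i+2})/q^{(j+1)(i-1)}$ for $i\in\{3,\dots,k\}$. Polynomials $h^{(j)}_{i,l}$: for fixed $J\ge 0$ and $i\in\{1,\dots,k\}$, define $h^{(j)}_{i,l}(q)$ for $j\ge J$, $l\in\{1,\dots,k\}$ by $h^{(J)}_{i,l}=1$ if $l=i$ and $0$ otherwise, and for $j\ge J$: \[ h^{(j+1)}_{i,1}=\sum_{\substack{1\le t\le k\\ t\equiv k \ (\mathrm{mod}\ 2)}}h^{(j)}_{i,t},\qquad h^{(j+1)}_{i,l}=(1+q^{j+1})\,q^{(l-2)(j+1)}\sum_{\substack{1\le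 t\le k-l+1\\ t\equiv l+k+1\ (\mathrm{mod}\ 2)}}h^{(j)}_{i,t}\quad (2\le l\le k). \] (These are exactly the coefficients obtained by repeatedly expressing $B_{(k-1)J+i}$ as $\sum_{l=1}^k h^{(j)}_{i,l}B_{(k-1)j+l}$ via the relations of the shelves.) A sequence of formal power series $P_t(q)=\sum_{s\ge0}p_{t,s}q^s$ has limit $\sum_{s\ge0}(\lim_{t\to\infty}p_{t,s})q^s$ if for each $s$ the integer sequence $(p_{t,s})_t$ is eventually constant. *)

theory Defs
  imports
    "HOL-Analysis.Analysis"
    "HOL-Computational_Algebra.Computational_Algebra"
    "HOL-Number_Theory.Cong"
begin

section \<open>The series \<open>B\<close>\<close>

abbreviation qv :: "complex fls" where "qv \<equiv> fls_X"

text \<open>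
  Infinite products over \<open>m \<ge> 1\<close> are written as library products over \<open>m \<ge> 0\<close> in the topology of
  formal power series, with \<open>Suc m\<close> in place of \<open>m\<close>.
\<close>

definition qfac_inf :: "complex fps" where
  "qfac_inf = (\<Prod>s. 1 - fps_X ^ Suc s)"

text \<open>
  For \<open>1 \<le> i \<le> k\<close> none of the subtractions in the exponents truncates, and all exponents are positive.
\<close>

definition B_base :: "nat \<Rightarrow> nat \<Rightarrow> complex fls" where
  "B_base k i =
     fps_to_fls (\<Prod>m. (1 - fps_X ^ (2 * k * Suc m))
                   * (1 - fps_X ^ (2 * k * Suc m - k + i - 1))
                   * (1 - fps_X ^ (2 * k * Suc m - k - i + 1)))
     / fps_to_fls qfac_inf"

text \<open>
  Here \<open>b i\<close> (\<open>1 \<le> i \<le> k\<close>) stands for \<open>B\<^bsub>(k-1)j+i\<^esub>\<close>; the value is the ghost series with the same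
  index, for \<open>2 \<le> i \<le> k\<close>.
\<close>

definition ghost :: "nat \<Rightarrow> nat \<Rightarrow> (nat \<Rightarrow> complex fls) \<Rightarrow> nat \<Rightarrow> complex fls" where
  "ghost k j b i =
     (if i = k then b (k - 1) / (1 + qv ^ (j + 1))
      else (b (i - 1) + qv ^ (j + 1) * b (i + 1)) / (1 + qv ^ (j + 1)))"

text \<open>
  \<open>shelf k j i\<close> is \<open>B\<^bsub>(k-1)j+i\<^esub>\<close> for \<open>1 \<le> i \<le> k\<close>. The separately stated rule for \<open>i = 2\<close> is the
  general one specialised to \<open>i = 2\<close>.
\<close>

primrec shelf :: "nat \<Rightarrow> nat \<Rightarrow> nat \<Rightarrow> complex fls" where
  "shelf k 0 = B_base k"
| "shelf k (Suc j) = (\<lambda>i.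
     if i = 1 then shelf k j k
     else (shelf k j (k - i + 1) - ghost k j (shelf k j) (k - i + 2)) / qv ^ ((j + 1) * (i - 1)))"

text \<open>
  The single sequence \<open>B\<^bsub>r\<^esub>\<close>, \<open>r \<ge> 1\<close>. Position \<open>k\<close> of a shelf is position \<open>1\<close> of the next one; the
  lemmas below show that this overlap is consistent and that all defining relations hold.
\<close>

definition B :: "nat \<Rightarrow> nat \<Rightarrow> complex fls" where
  "B k r = shelf k ((r - 1) div (k - 1)) ((r - 1) mod (k - 1) + 1)"

lemma B_shelf:
  assumes "k \<ge> 2" "i \<in> {1..k}"
  shows "B k ((k - 1) * j + i) = shelf k j i"
proof (cases "i = k")
  case True
  have "(k - 1) * j + i - 1 = (k - 1) * Suc j"
    using assms True by simp
  then have "((k - 1) * j + i - 1) div (k - 1) = Suc j" "((k - 1) * j + i - 1) mod (k - 1) = 0"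
    using assms(1) by (simp_all only: nonzero_mult_div_cancel_left mod_mult_self1_is_0)
  then have "B k ((k - 1) * j + i) = shelf k (Suc j) 1"
    unfolding B_def by (simp only: add_0)
  then show ?thesis
    using True by simp
next
  case False
  then have lt: "i - 1 < k - 1" and "(k - 1) * j + i - 1 = (k - 1) * j + (i - 1)"
    using assms by auto
  then have "((k - 1) * j + i - 1) div (k - 1) = j" "((k - 1) * j + i - 1) mod (k - 1) = i - 1"
    using lt by (simp_all only: div_mult_self4 mod_mult_self4 div_less mod_less)
  moreover have "i - 1 + 1 = i"
    using assms by simp
  ultimately show ?thesis
    unfolding B_def by (simp only:)
qed

lemma B_init:
  assumes "k \<ge> 2" "i \<in> {1..k}"
  shows "B k i = B_base k i"
  using B_shelf[OF assms, of 0] by simp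

lemma B_first:
  assumes "k \<ge> 2"
  shows "B k ((k - 1) * (j + 1) + 1) = B k ((k - 1) * j + k)"
  using assms by (subst (1 2) B_shelf) auto

lemma ghost_inner:
  assumes "i \<in> {2..k - 1}"
  shows "ghost k j (\<lambda>i. B k ((k - 1) * j + i)) i =
    (B k ((k - 1) * j + (i - 1)) + qv ^ (j + 1) * B k ((k - 1) * j + (i + 1))) / (1 + qv ^ (j + 1))"
  using assms by (auto simp: ghost_def)

lemma ghost_last:
  "ghost k j (\<lambda>i. B k ((k - 1) * j + i)) k = B k ((k - 1) * j + (k - 1)) / (1 + qv ^ (j + 1))"
  by (simp add: ghost_def)

lemma ghost_shelf:
  assumes "k \<ge> 2" "i \<in> {2..k}"
  shows "ghost k j (\<lambda>i. B k ((k - 1) * j + i)) i = ghost k j (shelf k j) i"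
proof (cases "i = k")
  case True
  then show ?thesis
    using assms B_shelf[of k "k - 1" j] by (simp add: ghost_def)
next
  case False
  then have "i - 1 \<in> {1..k}" "i + 1 \<in> {1..k}"
    using assms by auto
  then show ?thesis
    unfolding ghost_def using False assms(1) by (simp only: B_shelf if_False)
qed

lemma B_step:
  assumes "k \<ge> 2" "i \<in> {2..k}"
  shows "B k ((k - 1) * (j + 1) + i) =
    (B k ((k - 1) * j + (k - i + 1)) - ghost k j (\<lambda>i. B k ((k - 1) * j + i)) (k - i + 2))
      / qv ^ ((j + 1) * (i - 1))"
proof -
  have "B k ((k - 1) * (j + 1) + i) = shelf k (Suc j) i"
    using assms B_shelf[of k i "j + 1"] by simp
  moreover have "B k ((k - 1) * j + (k - i + 1)) = shelf k j (k - i + 1)"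
    using assms by (intro B_shelf) auto
  moreover have "ghost k j (\<lambda>i. B k ((k - 1) * j + i)) (k - i + 2) = ghost k j (shelf k j) (k - i + 2)"
    using assms by (intro ghost_shelf) auto
  ultimately show ?thesis
    using assms by simp
qed

lemma B_second:
  assumes "k \<ge> 2"
  shows "B k ((k - 1) * (j + 1) + 2) =
    (B k ((k - 1) * j + (k - 1)) - ghost k j (\<lambda>i. B k ((k - 1) * j + i)) k) / qv ^ (j + 1)"
proof -
  have "k - 2 + 1 = k - 1" "k - 2 + 2 = k"
    using assms by auto
  then show ?thesis
    using B_step[OF assms, of 2 j] assms by simp
qed


section \<open>The polynomials \<open>h\<close>\<close>

text \<open>
  The variable of the polynomials is \<open>monom 1 1\<close>. For \<open>j < J\<close> the value \<open>h k J i j\<close> is meaningless.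
\<close>

primrec h :: "nat \<Rightarrow> nat \<Rightarrow> nat \<Rightarrow> nat \<Rightarrow> nat \<Rightarrow> int poly" where
  "h k J i 0 = (\<lambda>l. if l = i then 1 else 0)"
| "h k J i (Suc j) = (\<lambda>l.
     if Suc j \<le> J then (if l = i then 1 else 0)
     else if l = 1 then (\<Sum>t | t \<in> {1..k} \<and> [t = k] (mod 2). h k J i j t)
     else (1 + monom 1 (j + 1)) * monom 1 ((l - 2) * (j + 1))
            * (\<Sum>t | t \<in> {1..k - l + 1} \<and> [t = l + k + 1] (mod 2). h k J i j t))"

lemma h_init: "h k J i J l = (if l = i then 1 else 0)"
  by (cases J) auto

lemma h_step_1:
  "j \<ge> J \<Longrightarrow> h k J i (j + 1) 1 = (\<Sum>t | t \<in> {1..k} \<and> [t = k] (mod 2). h k J i j t)"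
  by simp

lemma h_step:
  "j \<ge> J \<Longrightarrow> l \<in> {2..k} \<Longrightarrow> h k J i (j + 1) l =
    (1 + monom 1 (j + 1)) * monom 1 ((l - 2) * (j + 1))
      * (\<Sum>t | t \<in> {1..k - l + 1} \<and> [t = l + k + 1] (mod 2). h k J i j t)"
  by simp


section \<open>Limits\<close>

text \<open>The representative in \<open>{1, 2}\<close> modulo 2, written with an overline in the literature.\<close>

definition bar :: "nat \<Rightarrow> nat" where
  "bar n = (if odd n then 1 else 2)"

lemma bar_iff: "b = bar n \<longleftrightarrow> b \<in> {1, 2} \<and> [b = n] (mod 2)"
  by (auto simp: bar_def cong_def mod_2_eq_odd split: if_splits)

definition has_coeff_limit :: "(nat \<Rightarrow> int fps) \<Rightarrow> int fps \<Rightarrow> bool" where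
  "has_coeff_limit P L \<longleftrightarrow> (\<forall>s. \<forall>\<^sub>F t in sequentially. fps_nth (P t) s = fps_nth L s)"

lemma has_coeff_limit_iff_tendsto: "has_coeff_limit P L \<longleftrightarrow> P \<longlonglongrightarrow> L"
  by (simp add: has_coeff_limit_def tendsto_fps_iff)

definition int_fps_to_fls :: "int fps \<Rightarrow> complex fls" where
  "int_fps_to_fls f = fps_to_fls (Abs_fps (\<lambda>s. of_int (fps_nth f s)))"

end

theory Submission
  imports Defs
begin

text \<open>
  Position \<open>i\<close> of shelf \<open>j\<close> has the closed form
  \[ \frac{1}{(q)_\infty \prod_{s=1}^{j} (1 + q^s)} \sum_{N \ge 0} (-1)^N
       \prod_{s=1}^{j} (1 - q^{2(N+s)}) \, q^{k N^2 + (i - 1 + j (k - 1)) N}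
       (1 - q^{(k-i+1)(2N+j+1)}). \]
  On shelf \<open>0\<close> this is the Jacobi triple product, with the bilateral theta series folded at
  \<open>N \<mapsto> -N - 1\<close>; the shelf relations hold because the terms of the series recombine after an index
  shift. Only \<open>N = 0\<close> contributes below \<open>q\<^sup>j\<^sup>+\<^sup>1\<close>, where the quotient equals \<open>1\<close>. Writing a fixed member of
  shelf \<open>J\<close> as the combination of shelf \<open>j\<close> with coefficients \<open>h\<^bsub>l\<^esub>\<close>, the coefficients with \<open>l \<ge> 3\<close> are
  divisible by \<open>q\<^sup>j\<close> and, for parity reasons, only one of \<open>h\<^bsub>1\<^esub>\<close>, \<open>h\<^bsub>2\<^esub>\<close> is nonzero; that one therefore agrees
  with the series up to \<open>q\<^sup>j\<close>.
\<close>

section \<open>Formal power series up to a given order\<close>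

text \<open>Congruence modulo \<open>fps_X ^ m\<close>. Limits are handled below as families of such
  congruences, which reduces every statement to finite sums and products.\<close>

definition fps_agree :: "nat \<Rightarrow> 'a::zero fps \<Rightarrow> 'a fps \<Rightarrow> bool" where
  "fps_agree m f g \<longleftrightarrow> (\<forall>n<m. fps_nth f n = fps_nth g n)"

lemma fps_agree_refl [simp]: "fps_agree m f f"
  by (simp add: fps_agree_def)

lemma fps_agree_sym: "fps_agree m f g \<Longrightarrow> fps_agree m g f"
  by (simp add: fps_agree_def)

lemma fps_agree_trans [trans]: "fps_agree m f g \<Longrightarrow> fps_agree m g f' \<Longrightarrow> fps_agree m f f'"
  by (simp add: fps_agree_def)

lemma fps_agree_mono: "fps_agree m f g \<Longrightarrow> n \<le> m \<Longrightarrow> fps_agree n f g"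
  by (simp add: fps_agree_def)

lemma fps_agree_add:
  "fps_agree m f g \<Longrightarrow> fps_agree m f' g' \<Longrightarrow> fps_agree m (f + f') (g + g')"
  for f g :: "'a::monoid_add fps"
  by (simp add: fps_agree_def)

lemma fps_agree_diff:
  "fps_agree m f g \<Longrightarrow> fps_agree m f' g' \<Longrightarrow> fps_agree m (f - f') (g - g')"
  for f g :: "'a::group_add fps"
  by (simp add: fps_agree_def)

lemma fps_agree_mult:
  "fps_agree m f g \<Longrightarrow> fps_agree m f' g' \<Longrightarrow> fps_agree m (f * f') (g * g')"
  for f g :: "'a::semiring_0 fps"
  by (auto simp: fps_agree_def fps_mult_nth intro!: sum.cong)

lemma fps_agree_sum:
  "(\<And>x. x \<in> A \<Longrightarrow> fps_agree m (f x) (g x)) \<Longrightarrow> fps_agree m (sum f A) (sum g A)"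
  for f g :: "'b \<Rightarrow> 'a::comm_monoid_add fps"
  by (auto simp: fps_agree_def fps_sum_nth intro!: sum.cong)

lemma fps_agree_prod:
  "(\<And>x. x \<in> A \<Longrightarrow> fps_agree m (f x) (g x)) \<Longrightarrow> fps_agree m (prod f A) (prod g A)"
  for f g :: "'b \<Rightarrow> 'a::comm_semiring_1 fps"
  by (induction A rule: infinite_finite_induct) (auto intro: fps_agree_mult)

lemma fps_agree_X_power_mult_0: "m \<le> n \<Longrightarrow> fps_agree m (fps_X ^ n * f) 0"
  for f :: "'a::comm_ring_1 fps"
  by (simp add: fps_agree_def fps_X_power_mult_nth)

lemma fps_agree_dvd_0:
  assumes "fps_X ^ n dvd f" "m \<le> n"
  shows "fps_agree m (f :: 'a::comm_ring_1 fps) 0"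
  using assms by (auto elim!: dvdE intro: fps_agree_X_power_mult_0)

lemma fps_agree_one_minus_X_power: "m \<le> n \<Longrightarrow> fps_agree m (1 - fps_X ^ n) (1 :: 'a::comm_ring_1 fps)"
  by (simp add: fps_agree_def fps_X_power_nth)

lemma fps_agree_mult_cancel_right:
  assumes "fps_agree m (f * u) (g * u)" "fps_nth u 0 \<noteq> 0"
  shows "fps_agree m f (g :: 'a::field fps)"
proof -
  have "fps_agree m (f * u * inverse u) (g * u * inverse u)"
    by (intro fps_agree_mult assms fps_agree_refl)
  then show ?thesis
    using inverse_mult_eq_1'[OF assms(2)] by (simp add: mult.assoc)
qed

section \<open>Products of power series, finite and infinite\<close>

lemma fps_prod_nth_0: "fps_nth (\<Prod>x\<in>A. f x) 0 = (\<Prod>x\<in>A. fps_nth (f x) 0)"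
  for f :: "'b \<Rightarrow> 'a::comm_semiring_1 fps"
  by (induction A rule: infinite_finite_induct) auto

text \<open>Convergence of power series is eventual constancy of each coefficient. The alternative
  of \<open>has_prod\<close> established here asks for a nonzero limit, hence the second
  premise.\<close>

lemma has_prod_fpsI:
  fixes f :: "nat \<Rightarrow> 'a::idom fps"
  assumes "\<And>s. \<forall>\<^sub>F n in sequentially. fps_nth (\<Prod>i\<le>n. f i) s = fps_nth L s" "L \<noteq> 0"
  shows "f has_prod L"
  using assms by (simp add: has_prod_def raw_has_prod_def tendsto_fps_iff)

lemma fps_agree_prod_lessThan:
  fixes f :: "nat \<Rightarrow> 'a::comm_ring_1 fps"
  assumes "\<And>i. fps_agree (Suc i) (f i) 1" "n \<le> m"
  shows "fps_agree (Suc n) (\<Prod>i<m. f i) (\<Prod>i<n. f i)"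
proof -
  have "(\<Prod>i<m. f i) = (\<Prod>i<n. f i) * (\<Prod>i\<in>{n..<m}. f i)"
    using assms(2) by (subst prod.union_disjoint [symmetric]) (auto intro!: prod.cong)
  also have "fps_agree (Suc n) \<dots> ((\<Prod>i<n. f i) * (\<Prod>i\<in>{n..<m}. 1))"
    by (intro fps_agree_mult fps_agree_prod fps_agree_refl) (auto intro: fps_agree_mono assms(1))
  finally show ?thesis
    by simp
qed

lemma fps_agree_prodinf:
  fixes f :: "nat \<Rightarrow> 'a::idom fps"
  assumes "\<And>i. fps_agree (Suc i) (f i) 1"
  shows "fps_agree (Suc n) (prodinf f) (\<Prod>i<n. f i)"
proof -
  \<comment> \<open>Diagonal candidate for the limit: the coefficient of degree \<open>n\<close> no
    longer changes once the first \<open>n\<close> factors are multiplied.\<close>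
  define L where "L = Abs_fps (\<lambda>n. fps_nth (\<Prod>i<n. f i) n)"
  have L: "fps_agree (Suc m) L (\<Prod>i<m. f i)" for m
    unfolding fps_agree_def L_def
    using fps_agree_prod_lessThan[of f, OF assms] by (auto simp: fps_agree_def less_Suc_eq_le)
  have "fps_nth L 0 = 1"
    using L[of 0] by (simp add: fps_agree_def)
  then have "L \<noteq> 0"
    by auto
  then have "f has_prod L"
  proof (rule has_prod_fpsI[rotated])
    fix s
    have "fps_nth (\<Prod>i\<le>m. f i) s = fps_nth L s" if "m \<ge> s" for m
      using L[of "Suc m"] that by (simp add: fps_agree_def lessThan_Suc_atMost)
    then show "\<forall>\<^sub>F m in sequentially. fps_nth (\<Prod>i\<le>m. f i) s = fps_nth L s"
      unfolding eventually_sequentially by blast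
  qed
  then show ?thesis
    using L has_prod_unique by metis
qed

section \<open>Infinite sums of power series\<close>

text \<open>A sum of the whole series only for families with \<open>fps_X ^ N dvd f N\<close>.\<close>

definition fps_series :: "(nat \<Rightarrow> 'a::comm_monoid_add fps) \<Rightarrow> 'a fps" where
  "fps_series f = Abs_fps (\<lambda>n. \<Sum>N\<le>n. fps_nth (f N) n)"

text \<open>Divisibility puts the summand \<open>f N\<close> in degrees at least \<open>N\<close>,
  so neither the cut at \<open>N \<le> n\<close> in the definition nor the cut at \<open>m\<close>
  loses a contribution in the degrees compared.\<close>

lemma fps_agree_series:
  fixes f :: "nat \<Rightarrow> 'a::comm_ring_1 fps"
  assumes "\<And>N. fps_X ^ N dvd f N" "n \<le> m"
  shows "fps_agree n (fps_series f) (\<Sum>N<m. f N)"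
  unfolding fps_agree_def
proof (intro allI impI)
  fix s assume s: "s < n"
  have "fps_nth (f N) s = 0" if "s < N" for N
    using fps_agree_dvd_0[OF assms(1)[of N], of "Suc s"] that by (simp add: fps_agree_def)
  then show "fps_nth (fps_series f) s = fps_nth (\<Sum>N<m. f N) s"
    unfolding fps_series_def using s assms(2)
    by (auto simp: fps_sum_nth not_le intro!: sum.mono_neutral_left) (meson not_le)
qed

lemma fps_eqI_agree: "(\<And>n. fps_agree n f g) \<Longrightarrow> f = g"
  by (rule fps_ext) (auto simp: fps_agree_def)

lemma fps_series_diff: "fps_series (\<lambda>N. f N - g N) = fps_series f - fps_series g"
  for f g :: "nat \<Rightarrow> 'a::ab_group_add fps"
  by (rule fps_ext) (simp add: fps_series_def sum_subtractf)

text \<open>Multiplication by \<open>c\<close> mixes degrees, while the defining sum is cut at a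
  bound that depends on the degree. The divisibility premise makes the cut immaterial.\<close>

lemma fps_series_cmult:
  fixes f :: "nat \<Rightarrow> 'a::comm_ring_1 fps"
  assumes "\<And>N. fps_X ^ N dvd f N"
  shows "fps_series (\<lambda>N. c * f N) = c * fps_series f"
proof (rule fps_eqI_agree)
  fix n
  have "fps_agree n (fps_series (\<lambda>N. c * f N)) (\<Sum>N<n. c * f N)"
    by (intro fps_agree_series) (auto intro: assms dvd_mult)
  also have "(\<Sum>N<n. c * f N) = c * (\<Sum>N<n. f N)"
    by (simp add: sum_distrib_left)
  also have "fps_agree n \<dots> (c * fps_series f)"
    by (intro fps_agree_mult fps_agree_refl fps_agree_sym[OF fps_agree_series] assms) auto
  finally show "fps_agree n (fps_series (\<lambda>N. c * f N)) (c * fps_series f)" .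
qed

text \<open>Reindexing of one half of a series: nothing is lost at the start because
  \<open>P 0 = 0\<close>, and the boundary term \<open>P n\<close> of a partial sum vanishes modulo
  \<open>fps_X ^ n\<close>. Both shelf recursions rest on this.\<close>

lemma fps_series_shift:
  fixes P Q :: "nat \<Rightarrow> 'a::comm_ring_1 fps"
  assumes "\<And>N. fps_X ^ N dvd P N" "\<And>N. fps_X ^ N dvd Q N" "P 0 = 0"
  shows "fps_series (\<lambda>N. P N + Q N) = fps_series (\<lambda>N. P (Suc N) + Q N)"
proof (rule fps_eqI_agree)
  fix n
  have P: "fps_agree n (P n) 0"
    by (intro fps_agree_dvd_0[OF assms(1)]) auto
  have S: "fps_X ^ N dvd P (Suc N)" for N
    by (rule dvd_trans[OF le_imp_power_dvd assms(1)]) simp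
  have "fps_agree n (fps_series (\<lambda>N. P N + Q N)) (\<Sum>N<n. P N + Q N)"
    by (intro fps_agree_series dvd_add assms) auto
  also have "fps_agree n \<dots> ((\<Sum>N<n. P N + Q N) + P n)"
    using fps_agree_add[OF fps_agree_refl fps_agree_sym[OF P]] by simp
  also have "(\<Sum>N<n. P N + Q N) + P n = (\<Sum>N<n. P (Suc N) + Q N)"
    using sum.lessThan_Suc_shift[of P n] by (simp add: sum.distrib assms(3))
  also have "fps_agree n \<dots> (fps_series (\<lambda>N. P (Suc N) + Q N))"
    by (intro fps_agree_sym[OF fps_agree_series] dvd_add S assms) auto
  finally show "fps_agree n (fps_series (\<lambda>N. P N + Q N)) (fps_series (\<lambda>N. P (Suc N) + Q N))" .
qed

section \<open>Numerators of the closed form and their recursions\<close>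

section \<open>The closed form of the shelves\<close>

text \<open>In Pochhammer notation with base the square of q, this is the quotient of the factorials
  of length \<open>N + j\<close> and \<open>N\<close>, written without division.\<close>

definition shelf_weight :: "nat \<Rightarrow> nat \<Rightarrow> 'a::comm_ring_1 fps" where
  "shelf_weight j N = (\<Prod>s<j. 1 - fps_X ^ (2 * (N + Suc s)))"

lemma shelf_weight_Suc: "shelf_weight (Suc j) N = shelf_weight j N * (1 - fps_X ^ (2 * (N + Suc j)))"
  by (simp add: shelf_weight_def)

text \<open>Splitting off the first factor instead of the last trades the step in \<open>j\<close>
  for a step in \<open>N\<close>. This lets a shifted term of shelf \<open>j\<close> match a term of
  shelf \<open>Suc j\<close>.\<close>

lemma shelf_weight_Suc': "shelf_weight (Suc j) N = (1 - fps_X ^ (2 * Suc N)) * shelf_weight j (Suc N)"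
  unfolding shelf_weight_def by (subst prod.lessThan_Suc_shift) simp

definition shelf_term :: "nat \<Rightarrow> nat \<Rightarrow> nat \<Rightarrow> nat \<Rightarrow> 'a::comm_ring_1 fps" where
  "shelf_term k j i N = (-1) ^ N * shelf_weight j N
     * fps_X ^ (k * N\<^sup>2 + (i - 1 + j * (k - 1)) * N)
     * (1 - fps_X ^ ((k + 1 - i) * (2 * N + j + 1)))"

text \<open>Only the numerator of the closed form. Leaving the denominator aside keeps the
  recursions valid over every commutative ring.\<close>

definition shelf_series :: "nat \<Rightarrow> nat \<Rightarrow> nat \<Rightarrow> 'a::comm_ring_1 fps" where
  "shelf_series k j i = fps_series (shelf_term k j i)"

lemma le_mult_square: "k \<ge> 1 \<Longrightarrow> N \<le> k * N\<^sup>2" for k N :: nat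
  by (metis le_trans mult_le_mono1 mult_1 power2_eq_square le_square)

lemma X_power_dvd_monomial:
  "k \<ge> 1 \<Longrightarrow> fps_X ^ N dvd c * fps_X ^ (k * N\<^sup>2 + e) * (d :: 'a::comm_ring_1 fps)"
  by (intro dvd_mult2 dvd_mult le_imp_power_dvd) (meson le_mult_square trans_le_add1)

lemma X_power_dvd_shelf_term: "k \<ge> 1 \<Longrightarrow> fps_X ^ N dvd shelf_term k j i N"
  unfolding shelf_term_def by (rule X_power_dvd_monomial)

text \<open>
  With the value \<open>0\<close> at the fictitious position \<open>k + 1\<close>, the last ghost series of a shelf obeys the
  same rule as the inner ones.
\<close>

lemma shelf_series_beyond: "shelf_series k j (Suc k) = 0"
  by (simp add: shelf_series_def shelf_term_def fps_series_def fps_eq_iff)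

text \<open>The shelf relation with the ghost series eliminated and denominators cleared. Each term
  is a difference of two monomials; the leading monomials of the two series on the right are paired
  in \<open>P\<close>, the trailing ones in \<open>Q\<close>, and \<open>P\<close> is shifted by
  one.\<close>

lemma shelf_series_step:
  assumes "i \<in> {2..k}"
  shows "fps_X ^ ((j + 1) * (i - 2)) * shelf_series k (Suc j) i
         = shelf_series k j (k - i + 1) - (shelf_series k j (k - i + 3) :: 'a::comm_ring_1 fps)"
proof -
  \<comment> \<open>With \<open>i = p + 2\<close> and \<open>k = n + p + 2\<close>, no subtraction
    remains in the exponents.\<close>
  define p where "p = i - 2"
  define n where "n = k - i"
  have i: "i = p + 2" and k: "k = n + p + 2"
    using assms by (auto simp: p_def n_def)
  define e where "e N = k * N\<^sup>2 + j * (k - 1) * N" for N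
  define P :: "nat \<Rightarrow> 'a fps" where
    "P N = (-1) ^ N * shelf_weight j N * fps_X ^ (e N + n * N) * (1 - fps_X ^ (2 * N))" for N
  define Q :: "nat \<Rightarrow> 'a fps" where
    "Q N = (-1) ^ N * shelf_weight j N * fps_X ^ (e N + (n + 2) * N + p * (2 * N + j + 1))
           * (1 - fps_X ^ (2 * (N + Suc j)))" for N
  have "shelf_series k j (n + 1) - shelf_series k j (n + 3) =
        fps_series (\<lambda>N. shelf_term k j (n + 1) N - (shelf_term k j (n + 3) N :: 'a fps))"
    by (simp add: shelf_series_def fps_series_diff)
  also have "\<dots> = fps_series (\<lambda>N. P N + Q N)"
  proof (rule arg_cong[of _ _ fps_series], rule ext)
    fix N
    have "shelf_term k j (n + 1) N = (-1) ^ N * shelf_weight j N *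
       (fps_X ^ (e N + n * N) - (fps_X ^ (e N + n * N + (p + 2) * (2 * N + j + 1)) :: 'a fps))"
      by (simp add: shelf_term_def k e_def algebra_simps power2_eq_square del: power_Suc flip: power_add)
    moreover have "shelf_term k j (n + 3) N = (-1) ^ N * shelf_weight j N *
       (fps_X ^ (e N + (n + 2) * N) - (fps_X ^ (e N + (n + 2) * N + p * (2 * N + j + 1)) :: 'a fps))"
      by (simp add: shelf_term_def k e_def algebra_simps power2_eq_square del: power_Suc flip: power_add)
    moreover have "P N = (-1) ^ N * shelf_weight j N *
        (fps_X ^ (e N + n * N) - fps_X ^ (e N + (n + 2) * N))"
      by (simp add: P_def algebra_simps mult_2_right del: power_Suc flip: power_add)
    moreover have "Q N = (-1) ^ N * shelf_weight j N *
        (fps_X ^ (e N + (n + 2) * N + p * (2 * N + j + 1)) - fps_X ^ (e N + n * N + (p + 2) * (2 * N + j + 1)))"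
      by (simp add: Q_def algebra_simps del: power_Suc flip: power_add)
    moreover have "u * (a - b) - u * (c - d) = u * (a - c) + u * (d - b)" for a b c d u :: "'a fps"
      by (simp add: algebra_simps)
    ultimately show "shelf_term k j (n + 1) N - shelf_term k j (n + 3) N = P N + Q N"
      by (simp only:)
  qed
  also have "\<dots> = fps_series (\<lambda>N. P (Suc N) + Q N)"
  proof (rule fps_series_shift)
    show "fps_X ^ N dvd P N" "fps_X ^ N dvd Q N" for N
      unfolding P_def Q_def e_def add.assoc by (intro X_power_dvd_monomial; simp add: k)+
  qed (simp add: P_def)
  also have "(\<lambda>N. P (Suc N) + Q N) = (\<lambda>N. fps_X ^ ((j + 1) * p) * shelf_term k (Suc j) i N)"
  proof
    fix N
    \<comment> \<open>The exponent of the leading monomial on the shelf \<open>Suc j\<close> side.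
      It belongs to \<open>Q N\<close>; the trailing monomial is \<open>P (Suc N)\<close>, whose
      sign comes from the extra factor -1.\<close>
    define a where "a = (j + 1) * p + (k * N\<^sup>2 + (i - 1 + Suc j * (k - 1)) * N)"
    have "fps_X ^ ((j + 1) * p) * shelf_term k (Suc j) i N =
       (-1) ^ N * shelf_weight (Suc j) N * (fps_X ^ a - (fps_X ^ (a + (n + 1) * (2 * N + Suc j + 1)) :: 'a fps))"
      unfolding shelf_term_def a_def by (simp only: i k power_add) (simp add: algebra_simps)
    moreover have "a = e N + (n + 2) * N + p * (2 * N + j + 1)"
      by (simp add: a_def e_def i k algebra_simps power2_eq_square)
    then have "Q N = (-1) ^ N * shelf_weight (Suc j) N * fps_X ^ a"
      by (simp add: Q_def shelf_weight_Suc mult_ac)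
    moreover have e: "a + (n + 1) * (2 * N + Suc j + 1) = e (Suc N) + n * Suc N"
      by (simp add: a_def e_def i k algebra_simps power2_eq_square)
    have "P (Suc N) = - ((-1) ^ N * shelf_weight (Suc j) N * fps_X ^ (a + (n + 1) * (2 * N + Suc j + 1)))"
      unfolding P_def shelf_weight_Suc' power_Suc[of "-1"] e
      by (simp only: mult_minus_left mult_minus_right mult_1 mult_ac)
    ultimately show "P (Suc N) + Q N = fps_X ^ ((j + 1) * p) * shelf_term k (Suc j) i N"
      by (simp add: algebra_simps)
  qed
  also have "fps_series \<dots> = fps_X ^ ((j + 1) * p) * shelf_series k (Suc j) i"
    unfolding shelf_series_def by (intro fps_series_cmult X_power_dvd_shelf_term) (simp add: k)
  finally show ?thesis
    by (simp add: p_def n_def)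
qed

text \<open>Position \<open>k\<close> of one shelf is position 1 of the next, and the factor on the
  right is the quotient of their denominators. The proof again splits into \<open>P\<close> and
  \<open>Q\<close> and shifts \<open>P\<close>.\<close>

lemma shelf_series_step_first:
  assumes "k \<ge> 1"
  shows "shelf_series k (Suc j) 1 = (1 + fps_X ^ Suc j) * (shelf_series k j k :: 'a::comm_ring_1 fps)"
proof -
  obtain l where k: "k = Suc l"
    using assms by (cases k) auto
  define e where "e N = k * N\<^sup>2 + Suc j * l * N" for N
  define P :: "nat \<Rightarrow> 'a fps" where
    "P N = (-1) ^ N * shelf_weight j N * fps_X ^ (e N + Suc j) * (1 - fps_X ^ (2 * N))" for N
  define Q :: "nat \<Rightarrow> 'a fps" where
    "Q N = (-1) ^ N * shelf_weight j N * fps_X ^ e N * (1 - fps_X ^ (2 * (N + Suc j)))" for N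
  have "(1 + fps_X ^ Suc j) * (shelf_series k j k :: 'a fps) =
        fps_series (\<lambda>N. (1 + fps_X ^ Suc j) * shelf_term k j k N)"
    unfolding shelf_series_def using assms
    by (intro fps_series_cmult[symmetric] X_power_dvd_shelf_term)
  also have "(\<lambda>N. (1 + fps_X ^ Suc j) * shelf_term k j k N) = (\<lambda>N. P N + Q N)"
  proof
    fix N
    have "shelf_term k j k N =
        (-1) ^ N * shelf_weight j N * fps_X ^ e N * (1 - fps_X ^ (2 * N) * (fps_X ^ Suc j :: 'a fps))"
      by (simp add: shelf_term_def e_def k algebra_simps mult_2_right del: power_Suc flip: power_add)
    moreover have "fps_X ^ (2 * (N + Suc j)) = fps_X ^ (2 * N) * fps_X ^ Suc j * (fps_X ^ Suc j :: 'a fps)"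
      by (simp add: algebra_simps mult_2 del: power_Suc flip: power_add)
    \<comment> \<open>Rests on \<open>(1 + q) * (1 - b * q) = q * (1 - b) + (1 - b * q * q)\<close>,
      which produces a part vanishing at \<open>N = 0\<close> and a part that extends the
      weight.\<close>
    moreover have "(1 + q) * (u * a * (1 - b * q)) = u * (a * q) * (1 - b) + u * a * (1 - b * q * q)"
      for a b q u :: "'a fps"
      by (simp add: algebra_simps)
    ultimately show "(1 + fps_X ^ Suc j) * shelf_term k j k N = P N + Q N"
      by (simp only: P_def Q_def power_add[of _ "e N"])
  qed
  also have "fps_series \<dots> = fps_series (\<lambda>N. P (Suc N) + Q N)"
  proof (rule fps_series_shift)
    show "fps_X ^ N dvd P N" "fps_X ^ N dvd Q N" for N
      unfolding P_def Q_def e_def add.assoc by (intro X_power_dvd_monomial; simp add: k)+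
  qed (simp add: P_def)
  also have "(\<lambda>N. P (Suc N) + Q N) = shelf_term k (Suc j) 1"
  proof
    fix N
    have "shelf_term k (Suc j) 1 N = (-1) ^ N * shelf_weight (Suc j) N *
            (fps_X ^ e N - (fps_X ^ (e N + k * (2 * N + Suc j + 1)) :: 'a fps))"
      by (simp add: shelf_term_def k e_def algebra_simps power2_eq_square del: power_Suc flip: power_add)
    moreover have "Q N = (-1) ^ N * shelf_weight (Suc j) N * fps_X ^ e N"
      by (simp add: Q_def shelf_weight_Suc mult_ac)
    moreover have e: "e N + k * (2 * N + Suc j + 1) = e (Suc N) + Suc j"
      by (simp add: e_def k algebra_simps power2_eq_square)
    have "P (Suc N) = - ((-1) ^ N * shelf_weight (Suc j) N * fps_X ^ (e N + k * (2 * N + Suc j + 1)))"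
      unfolding P_def shelf_weight_Suc' power_Suc[of "-1"] e
      by (simp only: mult_minus_left mult_minus_right mult_1 mult_ac)
    ultimately show "P (Suc N) + Q N = shelf_term k (Suc j) 1 N"
      by (simp add: algebra_simps)
  qed
  finally show ?thesis
    by (simp add: shelf_series_def)
qed

section \<open>Gaussian binomials, and the triple product as a limit of finite products\<close>

section \<open>The finite and the infinite triple product\<close>

primrec qbinomial :: "'a::comm_ring_1 \<Rightarrow> nat \<Rightarrow> nat \<Rightarrow> 'a" where
  "qbinomial p 0 r = (if r = 0 then 1 else 0)"
| "qbinomial p (Suc n) r =
     qbinomial p n r + (if r = 0 then 0 else p ^ (Suc n - r) * qbinomial p n (r - 1))"

lemma qbinomial_eq_0: "n < r \<Longrightarrow> qbinomial p n r = 0"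
  by (induction n arbitrary: r) auto

text \<open>The homogeneous form in \<open>a\<close> and \<open>b\<close> avoids negative powers in
  the later specialisation.\<close>

lemma q_binomial_theorem:
  "(\<Prod>r<n. a + b * p ^ r) = (\<Sum>r\<le>n. a ^ (n - r) * b ^ r * p ^ (r choose 2) * qbinomial p n r)"
proof (induction n)
  case 0
  then show ?case by (simp add: numeral_2_eq_2)
next
  case (Suc n)
  define c where "c r = a ^ (n - r) * b ^ r * p ^ (r choose 2) * qbinomial p n r" for r
  define c' where "c' r = a ^ (Suc n - r) * b ^ r * p ^ (r choose 2) * qbinomial p (Suc n) r" for r
  have c0: "c' 0 = a * c 0"
    by (simp add: c_def c'_def numeral_2_eq_2)
  \<comment> \<open>The Pascal recursion at the level of summands: the two parts come from
    \<open>a\<close> and from \<open>b * p ^ n\<close> in the new factor.\<close>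
  have cS: "c' (Suc r) = (if r = n then 0 else a * c (Suc r)) + b * p ^ n * c r" if "r \<le> n" for r
  proof -
    have "(Suc r choose 2) + (n - r) = (r choose 2) + n"
      using that by (simp add: numeral_2_eq_2)
    then have e: "p ^ (Suc r choose 2) * p ^ (n - r) = p ^ (r choose 2) * p ^ n"
      by (metis power_add)
    have "c' (Suc r) = a ^ (n - r) * b ^ Suc r * p ^ (Suc r choose 2) * qbinomial p n (Suc r)
        + a ^ (n - r) * b ^ Suc r * (p ^ (Suc r choose 2) * p ^ (n - r)) * qbinomial p n r"
      by (simp add: c'_def algebra_simps)
    also have "\<dots> = a ^ (n - r) * b ^ Suc r * p ^ (Suc r choose 2) * qbinomial p n (Suc r) + b * p ^ n * c r"
      unfolding e by (simp add: c_def algebra_simps)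
    also have "a ^ (n - r) * b ^ Suc r * p ^ (Suc r choose 2) * qbinomial p n (Suc r) =
        (if r = n then 0 else a * c (Suc r))"
    proof (cases "r = n")
      case False
      then have "n - r = Suc (n - Suc r)"
        using that by simp
      with False show ?thesis
        by (simp add: c_def mult_ac)
    qed (simp add: qbinomial_eq_0)
    finally show ?thesis .
  qed
  have "(\<Prod>r<Suc n. a + b * p ^ r) = (\<Sum>r\<le>n. c r) * (a + b * p ^ n)"
    by (simp add: Suc c_def)
  also have "\<dots> = a * (\<Sum>r\<le>n. c r) + b * p ^ n * (\<Sum>r\<le>n. c r)"
    by (simp add: algebra_simps)
  also have "(\<Sum>r\<le>n. c r) = c 0 + (\<Sum>r<n. c (Suc r))"
    by (simp add: sum.atMost_shift)
  also have "a * \<dots> = a * c 0 + (\<Sum>r\<le>n. if r = n then 0 else a * c (Suc r))"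
    by (simp add: distrib_left sum_distrib_left flip: lessThan_Suc_atMost)
  also have "\<dots> + b * p ^ n * (c 0 + (\<Sum>r<n. c (Suc r))) = c' 0 + (\<Sum>r\<le>n. c' (Suc r))"
    by (simp add: cS c0 sum.distrib sum_distrib_left[symmetric] sum.atMost_shift[of c])
  also have "\<dots> = (\<Sum>r\<le>Suc n. c' r)"
    by (simp only: sum.atMost_Suc_shift)
  finally show ?case
    by (simp add: c'_def)
qed

text \<open>The quotient formula with denominators cleared. The two Pascal summands contribute
  \<open>1 - p ^ (Suc n - r)\<close> and \<open>p ^ (Suc n - r) * (1 - p ^ r)\<close>, which add up
  to \<open>1 - p ^ Suc n\<close>.\<close>

lemma qbinomial_mult_q_factorials:
  "r \<le> n \<Longrightarrow> qbinomial p n r * (\<Prod>s<r. 1 - p ^ Suc s) * (\<Prod>s<n - r. 1 - p ^ Suc s)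
     = (\<Prod>s<n. 1 - p ^ Suc s)"
proof (induction n arbitrary: r)
  case (Suc n)
  define F where "F m = (\<Prod>s<m. 1 - p ^ Suc s)" for m
  have FS: "F (Suc m) = F m * (1 - p ^ Suc m)" for m
    by (simp add: F_def)
  have IH: "qbinomial p n r * F r * F (n - r) = F n" if "r \<le> n" for r
    using Suc.IH[OF that] by (simp add: F_def)
  have 1: "qbinomial p n r * F r * F (Suc n - r) = (1 - p ^ (Suc n - r)) * F n"
  proof (cases "r = Suc n")
    case False
    then have "Suc n - r = Suc (n - r)" "r \<le> n"
      using Suc.prems by auto
    then show ?thesis
      using IH[of r] FS[of "n - r"] by (metis mult.assoc mult.commute)
  qed (simp add: qbinomial_eq_0)
  have 2: "(if r = 0 then 0 else p ^ (Suc n - r) * qbinomial p n (r - 1)) * F r * F (Suc n - r)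
      = p ^ (Suc n - r) * (1 - p ^ r) * F n"
  proof (cases r)
    case (Suc r')
    have "p ^ (n - r') * qbinomial p n r' * F (Suc r') * F (n - r') =
        p ^ (n - r') * (1 - p ^ Suc r') * (qbinomial p n r' * F r' * F (n - r'))"
      by (simp only: FS mult_ac)
    with Suc show ?thesis
      using IH[of r'] Suc.prems by (simp del: power_Suc)
  qed simp
  have "p ^ (Suc n - r) * p ^ r = p ^ Suc n"
    using Suc.prems by (simp add: power_add[symmetric] del: power_Suc)
  then have "qbinomial p (Suc n) r * F r * F (Suc n - r) = (1 - p ^ Suc n) * F n"
    using 1 2 by (simp only: qbinomial.simps distrib_right) (simp add: algebra_simps del: power_Suc)
  then show ?case
    by (simp add: F_def mult_ac)
qed simp

text \<open>Finite Jacobi triple product: the q-binomial theorem with \<open>2 * M\<close> factors,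
  expanded about the central index \<open>M\<close>. The first sum holds the bilateral indices
  \<open>N \<ge> 0\<close>, the second the indices \<open>-N - 1\<close>, whose extra sign is the
  minus between the sums.\<close>

lemma finite_triple_product:
  assumes i: "i \<in> {1..k}"
  shows "(\<Prod>m<M. (1 - fps_X ^ (2 * k * Suc m - k + i - 1)) * (1 - fps_X ^ (2 * k * Suc m - k - i + 1)))
    = (\<Sum>N\<le>M. (-1) ^ N * fps_X ^ (k * N\<^sup>2 + (i - 1) * N) * qbinomial (fps_X ^ (2 * k)) (2 * M) (M + N))
    - (\<Sum>N<M. (-1) ^ N * fps_X ^ (k * (Suc N)\<^sup>2 - (i - 1) * Suc N) *
        qbinomial (fps_X ^ (2 * k)) (2 * M) (M - Suc N) :: 'a::idom fps)"
proof (cases M)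
  case 0
  then show ?thesis by simp
next
  case (Suc M')
  define x :: "'a fps" where "x = fps_X ^ k"
  define z :: "'a fps" where "z = fps_X ^ (i - 1)"
  define F where "F m = (1 - fps_X ^ (2 * k * Suc m - k + i - 1)) * (1 - fps_X ^ (2 * k * Suc m - k - i + 1) :: 'a fps)" for m
  \<comment> \<open>With \<open>a = x ^ (2M - 1)\<close>, \<open>b = -z\<close>, \<open>p = x\<^sup>2\<close>, both sides of the \<open>q\<close>-binomial theorem are
    \<open>x ^ K * (-z) ^ M\<close> times those of the claim, and no negative exponents occur.\<close>
  define K where "K = 3 * M'\<^sup>2 + 4 * M' + 1"
  define qb where "qb = qbinomial (x\<^sup>2) (2 * M)"
  have nz: "x ^ n * (-z) ^ m \<noteq> 0" for n m
    by (simp add: x_def z_def)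
  \<comment> \<open>The second factor of \<open>F m\<close> involves the inverse of
    \<open>z\<close>; multiplication by \<open>z\<close> clears it.\<close>
  have F: "F m * z = (1 - z * x ^ (2 * m + 1)) * (z - x ^ (2 * m + 1))" for m
  proof -
    define d where "d = k * (2 * m + 1)"
    have "k * 1 \<le> d"
      unfolding d_def by (intro mult_le_mono) auto
    then have d: "i - 1 \<le> d"
      using i by auto
    have e: "2 * k * Suc m - k - i + 1 = d - (i - 1)" "2 * k * Suc m - k + i - 1 = i - 1 + d"
      using i unfolding d_def by (auto simp: algebra_simps)
    have "(1 - c * a) * (1 - b) * c = (1 - c * a) * (c - b * c)" for a b c :: "'a fps"
      by (simp add: algebra_simps)
    then have "F m * z = (1 - z * fps_X ^ d) * (z - fps_X ^ (d - (i - 1)) * z)"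
      unfolding F_def z_def e power_add .
    also have "fps_X ^ (d - (i - 1)) * z = fps_X ^ d"
      using d by (simp add: z_def flip: power_add)
    finally show ?thesis
      unfolding x_def d_def power_mult .
  qed
  \<comment> \<open>The product is cut in the middle and its lower half reversed, so that the
    factors with indices \<open>M - Suc m\<close> and \<open>M + m\<close> together give
    \<open>F m\<close> up to a monomial.\<close>
  have split: "{..<2 * M} = {..<M} \<union> {M..<2 * M}"
    by auto
  have "(\<Prod>r<2 * M. x ^ (2 * M - 1) + (-z) * (x\<^sup>2) ^ r) =
     (\<Prod>r<M. x ^ (2 * M - 1) + (-z) * (x\<^sup>2) ^ r) * (\<Prod>r\<in>{M..<2 * M}. x ^ (2 * M - 1) + (-z) * (x\<^sup>2) ^ r)"
    by (subst split, rule prod.union_disjoint) auto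
  also have "(\<Prod>r<M. x ^ (2 * M - 1) + (-z) * (x\<^sup>2) ^ r) = (\<Prod>m<M. x ^ (2 * M - 1) + (-z) * (x\<^sup>2) ^ (M - Suc m))"
    by (rule prod.nat_diff_reindex[symmetric])
  also have "(\<Prod>r\<in>{M..<2 * M}. x ^ (2 * M - 1) + (-z) * (x\<^sup>2) ^ r) = (\<Prod>m<M. x ^ (2 * M - 1) + (-z) * (x\<^sup>2) ^ (M + m))"
    by (rule prod.reindex_bij_witness[of _ "\<lambda>m. M + m" "\<lambda>r. r - M"]) auto
  also have "(\<Prod>m<M. x ^ (2 * M - 1) + (-z) * (x\<^sup>2) ^ (M - Suc m)) * \<dots>
     = (\<Prod>m<M. x ^ (2 * (M - Suc m) + (2 * M - 1)) * (-z) * F m)"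
    unfolding prod.distrib[symmetric]
  proof (rule prod.cong[OF refl])
    fix m assume "m \<in> {..<M}"
    then have "2 * M - 1 = 2 * (M - Suc m) + (2 * m + 1)"
      by auto
    then have 1: "x ^ (2 * M - 1) = x ^ (2 * (M - Suc m)) * x ^ (2 * m + 1)"
      by (metis power_add)
    have 2: "(x\<^sup>2) ^ (M + m) = x ^ (2 * M - 1) * x ^ (2 * m + 1)"
      using Suc by (simp flip: power_mult power_add power_Suc)
    have 3: "(x\<^sup>2) ^ (M - Suc m) = x ^ (2 * (M - Suc m))"
      by (simp flip: power_mult)
    have 4: "(u * v + (-z) * u) * (w + (-z) * (w * v)) = (u * (v - z)) * (w * (1 - z * v))" for u v w :: "'a fps"
      by (simp add: algebra_simps)
    have 5: "(u * (v - z)) * (w * (1 - z * v)) = (u * w) * - ((1 - z * v) * (z - v))" for u v w :: "'a fps"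
      by (simp add: algebra_simps)
    have "(x ^ (2 * M - 1) + (-z) * (x\<^sup>2) ^ (M - Suc m)) * (x ^ (2 * M - 1) + (-z) * (x\<^sup>2) ^ (M + m))
       = (x ^ (2 * (M - Suc m)) * (x ^ (2 * m + 1) - z)) * (x ^ (2 * M - 1) * (1 - z * x ^ (2 * m + 1)))"
      unfolding 2 3 by (subst 1) (rule 4)
    also have "\<dots> = x ^ (2 * (M - Suc m) + (2 * M - 1)) * - (F m * z)"
      unfolding F power_add[of x "2 * (M - Suc m)" "2 * M - 1"] by (rule 5)
    finally show "(x ^ (2 * M - 1) + (-z) * (x\<^sup>2) ^ (M - Suc m)) * (x ^ (2 * M - 1) + (-z) * (x\<^sup>2) ^ (M + m))
        = x ^ (2 * (M - Suc m) + (2 * M - 1)) * (-z) * F m"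
      by (simp add: mult_ac)
  qed
  also have "\<dots> = x ^ (\<Sum>m<M. 2 * (M - Suc m) + (2 * M - 1)) * (-z) ^ M * (\<Prod>m<M. F m)"
    by (simp only: prod.distrib power_sum prod_constant card_lessThan)
  also have "(\<Sum>m<M. 2 * (M - Suc m) + (2 * M - 1)) = (\<Sum>m<M. 2 * m + (2 * M - 1))"
    by (rule sum.nat_diff_reindex)
  also have "\<dots> = M * (M - 1) + M * (2 * M - 1)"
  proof -
    have "(\<Sum>m<n. 2 * m + e) = n * (n - 1) + n * e" for e n :: nat
    proof (induction n)
      case (Suc n)
      then show ?case
        by (cases n) (simp_all add: algebra_simps)
    qed simp
    then show ?thesis .
  qed
  also have "M * (M - 1) + M * (2 * M - 1) = K"
    by (simp add: K_def Suc power2_eq_square algebra_simps)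
  finally have L: "(\<Prod>r<2 * M. x ^ (2 * M - 1) + (-z) * (x\<^sup>2) ^ r) = x ^ K * (-z) ^ M * (\<Prod>m<M. F m)" .
  have choose: "2 * (r choose 2) = r * (r - 1)" for r
  proof -
    have "even (r * (r - 1))"
      by (cases r) auto
    then show ?thesis
      by (simp only: choose_two dvd_mult_div_cancel)
  qed
  define c where "c r = (x ^ (2 * M - 1)) ^ (2 * M - r) * (-z) ^ r * (x\<^sup>2) ^ (r choose 2) * qb r" for r
  have c_alt: "c r = x ^ ((2 * M - 1) * (2 * M - r) + 2 * (r choose 2)) * (-z) ^ r * qb r" for r
    unfolding c_def by (simp only: power_mult[symmetric] power_add mult_ac)
  \<comment> \<open>About the central index the linear terms of the exponent cancel, which leaves
    \<open>N\<^sup>2 + K\<close>.\<close>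
  have c1: "c (M + N) = x ^ K * (-z) ^ M * ((-1) ^ N * fps_X ^ (k * N\<^sup>2 + (i - 1) * N) * qb (M + N))"
    if "N \<le> M" for N
  proof -
    define P where "P = M - N"
    have P: "M = N + P"
      using that by (simp add: P_def)
    have "(2 * M - 1) * (2 * M - (M + N)) + 2 * ((M + N) choose 2) = N\<^sup>2 + K"
    proof (cases N)
      case 0
      then show ?thesis
        unfolding choose by (simp add: Suc K_def algebra_simps power2_eq_square)
    next
      case (Suc n)
      then have "M' = n + P"
        using P \<open>M = Suc M'\<close> by simp
      then show ?thesis
        unfolding choose K_def P Suc by (simp add: algebra_simps power2_eq_square)
    qed
    then have "c (M + N) = x ^ (N\<^sup>2 + K) * (-z) ^ (M + N) * qb (M + N)"
      by (simp only: c_alt)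
    also have "(-z) ^ (M + N) = (-z) ^ M * (-1) ^ N * z ^ N"
      by (simp add: power_add power_minus[of z N])
    finally have "c (M + N) = x ^ (N\<^sup>2 + K) * ((-z) ^ M * (-1) ^ N * z ^ N) * qb (M + N)" .
    moreover have "fps_X ^ (k * N\<^sup>2 + (i - 1) * N) = x ^ N\<^sup>2 * z ^ N"
      by (simp only: x_def z_def power_add power_mult)
    ultimately show ?thesis
      by (simp only: power_add mult_ac)
  qed
  have c2: "c (M - Suc N) = - (x ^ K * (-z) ^ M * ((-1) ^ N * fps_X ^ (k * (Suc N)\<^sup>2 - (i - 1) * Suc N) * qb (M - Suc N)))"
    if "N < M" for N
  proof -
    define r where "r = M - Suc N"
    have r: "M' = N + r" "M = r + Suc N"
      using that Suc by (auto simp: r_def)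
    have "2 * M - r = 2 * N + r + 2" "2 * M - 1 = 2 * N + 2 * r + 1"
      by (auto simp: r)
    then have "(2 * M - 1) * (2 * M - r) + 2 * (r choose 2) = (Suc N)\<^sup>2 + K"
      unfolding choose K_def r(1) by (cases r) (simp_all add: algebra_simps power2_eq_square)
    then have "c r = x ^ ((Suc N)\<^sup>2 + K) * (-z) ^ r * qb r"
      by (simp only: c_alt)
    \<comment> \<open>Here \<open>i - 1 \<le> k\<close> guarantees that the exponent with a
      subtraction does not truncate.\<close>
    moreover have "x ^ ((Suc N)\<^sup>2) = fps_X ^ (k * (Suc N)\<^sup>2 - (i - 1) * Suc N) * z ^ Suc N"
    proof -
      have "(i - 1) * Suc N \<le> k * (Suc N)\<^sup>2"
        using i unfolding power2_eq_square by (intro mult_le_mono) auto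
      then show ?thesis
        by (simp add: x_def z_def del: power_Suc flip: power_mult power_add)
    qed
    moreover have "(-z) ^ M * (-1) ^ N = - ((-z) ^ r * z ^ Suc N)"
      unfolding r(2) power_add power_minus[of z "Suc N"] by simp
    ultimately have e: "c r = fps_X ^ (k * (Suc N)\<^sup>2 - (i - 1) * Suc N) * z ^ Suc N * x ^ K * (-z) ^ r * qb r"
      "(-z) ^ M * (-1) ^ N = - ((-z) ^ r * z ^ Suc N)"
      by (simp_all only: power_add)
    have "u * v * (w * y * q) = u * (v * w) * y * q" for u v w y q :: "'a fps"
      by (simp only: mult_ac)
    then show ?thesis
      unfolding r_def[symmetric] e(1) by (simp only: e(2)) (simp only: mult_minus_left mult_minus_right minus_minus mult_ac)
  qed
  have split': "{..2 * M} = {..<M} \<union> {M..2 * M}"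
    by auto
  have "(\<Sum>r\<le>2 * M. c r) = (\<Sum>r<M. c r) + (\<Sum>r\<in>{M..2 * M}. c r)"
    by (subst split', rule sum.union_disjoint) auto
  also have "(\<Sum>r<M. c r) = (\<Sum>N<M. c (M - Suc N))"
    by (rule sum.nat_diff_reindex[symmetric])
  also have "(\<Sum>r\<in>{M..2 * M}. c r) = (\<Sum>N\<le>M. c (M + N))"
    by (rule sum.reindex_bij_witness[of _ "\<lambda>N. M + N" "\<lambda>r. r - M"]) auto
  finally have "x ^ K * (-z) ^ M * (\<Prod>m<M. F m) = (\<Sum>N<M. c (M - Suc N)) + (\<Sum>N\<le>M. c (M + N))"
    using L q_binomial_theorem[of "x ^ (2 * M - 1)" "-z" "x\<^sup>2" "2 * M"] by (simp add: c_def qb_def)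
  also have "\<dots> = x ^ K * (-z) ^ M *
     ((\<Sum>N\<le>M. (-1) ^ N * fps_X ^ (k * N\<^sup>2 + (i - 1) * N) * qb (M + N))
      - (\<Sum>N<M. (-1) ^ N * fps_X ^ (k * (Suc N)\<^sup>2 - (i - 1) * Suc N) * qb (M - Suc N)))"
    by (simp add: c1 c2 right_diff_distrib sum_distrib_left sum_negf)
  finally have "(\<Prod>m<M. F m) = (\<Sum>N\<le>M. (-1) ^ N * fps_X ^ (k * N\<^sup>2 + (i - 1) * N) * qb (M + N))
      - (\<Sum>N<M. (-1) ^ N * fps_X ^ (k * (Suc N)\<^sup>2 - (i - 1) * Suc N) * qb (M - Suc N))"
    by (simp only: mult_left_cancel[OF nz])
  then show ?thesis
    by (simp add: F_def qb_def x_def power_mult[symmetric] mult.commute[of k 2])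
qed

text \<open>By the factorial formula the product is \<open>F M * F n\<close> divided by
  \<open>F r * F (n - r)\<close>, and each of these four agrees with the unit \<open>F s\<close> in
  the degrees compared.\<close>

lemma fps_agree_qbinomial:
  fixes d s M r :: nat
  defines "p \<equiv> (fps_X :: 'a::field fps) ^ d"
  assumes d: "d \<ge> 1" and r: "s \<le> r" "r + s \<le> n" and M: "s \<le> M"
  shows "fps_agree (Suc s) ((\<Prod>t<M. 1 - p ^ Suc t) * qbinomial p n r) 1"
proof -
  define F where "F m = (\<Prod>t<m. 1 - p ^ Suc t)" for m
  have F: "fps_agree (Suc s) (F m) (F s)" if "s \<le> m" for m
    unfolding F_def
  proof (rule fps_agree_prod_lessThan[OF _ that])
    fix t
    have "Suc t \<le> d * Suc t"
      using mult_le_mono1[OF d, of "Suc t"] by simp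
    then show "fps_agree (Suc t) (1 - p ^ Suc t) 1"
      unfolding p_def power_mult[symmetric] by (rule fps_agree_one_minus_X_power)
  qed
  have "qbinomial p n r * F r * F (n - r) = F n"
    using qbinomial_mult_q_factorials[of r n p] r by (simp add: F_def)
  then have "fps_agree (Suc s) (F M * qbinomial p n r * F s) (F n)"
  proof -
    have "fps_agree (Suc s) (F M * qbinomial p n r * F s) (F (n - r) * qbinomial p n r * F r)"
      using M r by (intro fps_agree_mult fps_agree_refl fps_agree_trans[OF F fps_agree_sym[OF F]] fps_agree_sym[OF F]) auto
    then show ?thesis
      using \<open>_ = F n\<close> by (simp add: mult_ac)
  qed
  also have "fps_agree (Suc s) \<dots> (1 * F s)"
    using F[of n] r by simp
  finally show ?thesis
    unfolding F_def[symmetric]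
  proof (rule fps_agree_mult_cancel_right)
    show "fps_nth (F s) 0 \<noteq> 0"
      using d by (simp add: F_def p_def fps_prod_nth_0)
  qed
qed

text \<open>The Jacobi triple product: multiplied by \<open>F M\<close>, the Gaussian binomials in
  the finite version tend to 1.\<close>

lemma B_base_product:
  assumes i: "i \<in> {1..k}"
  shows "(\<Prod>m. (1 - fps_X ^ (2 * k * Suc m)) * (1 - fps_X ^ (2 * k * Suc m - k + i - 1))
           * (1 - fps_X ^ (2 * k * Suc m - k - i + 1))) = (shelf_series k 0 i :: 'a::field fps)"
    (is "prodinf ?f = _")
proof (rule has_prod_unique[symmetric], rule has_prod_fpsI)
  have k: "k \<ge> 1"
    using i by auto
  define p :: "'a fps" where "p = fps_X ^ (2 * k)"
  define F where "F M = (\<Prod>t<M. 1 - p ^ Suc t)" for M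
  define a :: "nat \<Rightarrow> 'a fps" where "a N = (-1) ^ N * fps_X ^ (k * N\<^sup>2 + (i - 1) * N)" for N
  define b :: "nat \<Rightarrow> 'a fps" where "b N = (-1) ^ N * fps_X ^ (k * (Suc N)\<^sup>2 - (i - 1) * Suc N)" for N
  have X_dvd_a: "fps_X ^ N dvd a N" for N
    using X_power_dvd_monomial[OF k, of N "(-1) ^ N" "(i - 1) * N" 1] by (simp add: a_def)
  \<comment> \<open>The bilateral theta terms with indices \<open>N\<close> and
    \<open>-N - 1\<close> merge into one term of shelf 0.\<close>
  have ab: "shelf_term k 0 i N = a N - b N" for N
  proof -
    define l where "l = k - i"
    define i' where "i' = i - 1"
    have *: "i = Suc i'" "k = l + i' + 1"
      using i by (auto simp: l_def i'_def)
    have "k * (Suc N)\<^sup>2 = (k * N\<^sup>2 + i' * N + (l + 1) * (2 * N + 1)) + i' * Suc N"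
      by (simp add: * algebra_simps power2_eq_square)
    then have "k * (Suc N)\<^sup>2 - (i - 1) * Suc N = k * N\<^sup>2 + i' * N + (l + 1) * (2 * N + 1)"
      by (simp add: *)
    then have b: "b N = (-1) ^ N * fps_X ^ (k * N\<^sup>2 + i' * N + (l + 1) * (2 * N + 1))"
      by (simp only: b_def)
    have "shelf_term k 0 i N = (-1) ^ N * fps_X ^ (k * N\<^sup>2 + i' * N) * (1 - fps_X ^ ((l + 1) * (2 * N + 1)) :: 'a fps)"
      by (simp add: shelf_term_def shelf_weight_def *)
    then show ?thesis
      unfolding a_def b i'_def[symmetric] by (simp only: right_diff_distrib power_add mult_1_right mult.assoc)
  qed
  have X_dvd_b: "fps_X ^ N dvd b N" for N
    using dvd_diff[OF X_dvd_a[of N] X_power_dvd_shelf_term[OF k, of N 0 i]] by (simp add: ab)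
  have partial: "(\<Prod>m<M. ?f m) = (\<Sum>N\<le>M. a N * (F M * qbinomial p (2 * M) (M + N)))
     - (\<Sum>N<M. b N * (F M * qbinomial p (2 * M) (M - Suc N)))" for M
  proof -
    have "(\<Prod>m<M. ?f m) = F M * (\<Prod>m<M. (1 - fps_X ^ (2 * k * Suc m - k + i - 1))
           * (1 - fps_X ^ (2 * k * Suc m - k - i + 1)))"
      unfolding F_def p_def power_mult[symmetric] prod.distrib by (simp only: mult_ac)
    then show ?thesis
      unfolding finite_triple_product[OF i]
      by (simp add: a_def b_def p_def right_diff_distrib sum_distrib_left mult_ac)
  qed
  \<comment> \<open>The bound \<open>2 * s + 1\<close> ensures that for \<open>N \<le> s\<close> the
    indices \<open>M + N\<close> and \<open>M - Suc N\<close> keep distance at least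
    \<open>s\<close> from both ends of the binomial row.\<close>
  have agree: "fps_agree (Suc s) (\<Prod>m<M. ?f m) (shelf_series k 0 i)" if "M \<ge> 2 * s + 1" for s M
  proof -
    have *: "fps_agree (Suc s) (c N * (F M * qbinomial p (2 * M) r)) (c N)"
      if "fps_X ^ N dvd c N" "N \<le> s \<Longrightarrow> s \<le> r \<and> r + s \<le> 2 * M" for c :: "nat \<Rightarrow> 'a fps" and N r
    proof (cases "N \<le> s")
      case True
      have "fps_agree (Suc s) (F M * qbinomial p (2 * M) r) 1"
        unfolding F_def p_def using True that k \<open>M \<ge> 2 * s + 1\<close> by (intro fps_agree_qbinomial) auto
      then show ?thesis
        using fps_agree_mult[OF fps_agree_refl, of _ _ 1 "c N"] by simp
    next
      case False
      then have "fps_agree (Suc s) (c N) 0"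
        by (intro fps_agree_dvd_0[OF that(1)]) auto
      from this fps_agree_mult[OF this fps_agree_refl] show ?thesis
        by (simp add: fps_agree_def)
    qed
    have "fps_agree (Suc s) (\<Prod>m<M. ?f m) ((\<Sum>N\<le>M. a N) - (\<Sum>N<M. b N))"
      unfolding partial using that
      by (intro fps_agree_diff fps_agree_sum *[of _ a] *[of _ b] X_dvd_a X_dvd_b) auto
    also have "\<dots> = (\<Sum>N<M. a N - b N) + a M"
      by (simp add: sum_subtractf flip: lessThan_Suc_atMost)
    also have "fps_agree (Suc s) \<dots> (shelf_series k 0 i + 0)"
      unfolding ab[symmetric] shelf_series_def using that
      by (intro fps_agree_add fps_agree_sym[OF fps_agree_series] fps_agree_dvd_0[OF X_dvd_a]
            X_power_dvd_shelf_term k) auto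
    finally show ?thesis
      by simp
  qed
  have "fps_nth (\<Prod>m\<le>n. ?f m) s = fps_nth (shelf_series k 0 i) s" if "n \<ge> 2 * s" for n s
    using agree[of s "Suc n"] that by (simp add: fps_agree_def lessThan_Suc_atMost)
  then show "\<forall>\<^sub>F n in sequentially. fps_nth (\<Prod>m\<le>n. ?f m) s = fps_nth (shelf_series k 0 i) s" for s
    unfolding eventually_sequentially by blast
  have "fps_nth (shelf_series k 0 i :: 'a fps) 0 = 1"
    using i by (simp add: shelf_series_def fps_series_def shelf_term_def shelf_weight_def)
  then show "(shelf_series k 0 i :: 'a fps) \<noteq> 0"
    by auto
qed

section \<open>The shelves as power series\<close>

lemma fps_agree_qfac_inf: "fps_agree (Suc j) qfac_inf (\<Prod>s<j. 1 - fps_X ^ Suc s)"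
  unfolding qfac_inf_def by (rule fps_agree_prodinf) (auto intro: fps_agree_one_minus_X_power simp del: power_Suc)

lemma fps_nth_qfac_inf_0: "fps_nth qfac_inf 0 = 1"
  using fps_agree_qfac_inf[of 0] by (simp add: fps_agree_def)

section \<open>Denominators and normalised shelves\<close>

definition shelf_denom :: "nat \<Rightarrow> complex fps" where
  "shelf_denom j = qfac_inf * (\<Prod>s<j. 1 + fps_X ^ Suc s)"

definition shelf_fps :: "nat \<Rightarrow> nat \<Rightarrow> nat \<Rightarrow> complex fps" where
  "shelf_fps k j i = shelf_series k j i * inverse (shelf_denom j)"

lemma fps_nth_shelf_denom_0: "fps_nth (shelf_denom j) 0 = 1"
  by (simp add: shelf_denom_def fps_nth_qfac_inf_0 fps_prod_nth_0)

lemma shelf_denom_Suc: "shelf_denom (Suc j) = (1 + fps_X ^ Suc j) * shelf_denom j"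
  by (simp add: shelf_denom_def mult_ac)

lemma shelf_fps_mult_denom: "shelf_fps k j i * shelf_denom j = shelf_series k j i"
  using inverse_mult_eq_1[of "shelf_denom j"]
  by (simp add: shelf_fps_def fps_nth_shelf_denom_0 mult.assoc)

lemma shelf_denom_nz: "shelf_denom j \<noteq> 0"
  using fps_nth_shelf_denom_0[of j] by auto

lemma shelf_fps_eqI: "f * shelf_denom j = shelf_series k j i \<Longrightarrow> shelf_fps k j i = f"
  using shelf_fps_mult_denom[of k j i] shelf_denom_nz[of j] by (metis mult_right_cancel)

lemma shelf_fps_beyond: "shelf_fps k j (Suc k) = 0"
  by (simp add: shelf_fps_def shelf_series_beyond)

lemma shelf_fps_step_first:
  assumes "k \<ge> 1"
  shows "shelf_fps k (Suc j) 1 = shelf_fps k j k"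
  by (rule shelf_fps_eqI)
    (metis shelf_series_step_first[OF assms] shelf_denom_Suc shelf_fps_mult_denom mult.left_commute)

lemma shelf_fps_step:
  assumes "i \<in> {2..k}"
  shows "(1 + fps_X ^ Suc j) * fps_X ^ (Suc j * (i - 2)) * shelf_fps k (Suc j) i
         = shelf_fps k j (k - i + 1) - shelf_fps k j (k - i + 3)" (is "?l = ?r")
proof -
  have "?l * shelf_denom j = fps_X ^ (Suc j * (i - 2)) * (shelf_fps k (Suc j) i * shelf_denom (Suc j))"
    by (simp add: shelf_denom_Suc mult_ac)
  also have "\<dots> = ?r * shelf_denom j"
    using shelf_series_step[OF assms, of j] by (simp add: shelf_fps_mult_denom left_diff_distrib)
  finally show ?thesis
    using shelf_denom_nz by simp
qed

text \<open>The closed form satisfies the initial values and the recursion that define the shelves;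
  all divisions are by nonzero Laurent series.\<close>

lemma shelf_eq_shelf_fps:
  assumes k: "k \<ge> 2"
  shows "i \<in> {1..k} \<Longrightarrow> shelf k j i = fps_to_fls (shelf_fps k j i)"
proof (induction j arbitrary: i)
  case 0
  have "fps_to_fls (shelf_series k 0 i) = fps_to_fls (shelf_fps k 0 i) * fps_to_fls qfac_inf"
    using shelf_fps_mult_denom[of k 0 i] by (simp add: shelf_denom_def flip: fls_times_fps_to_fls)
  moreover have "qfac_inf \<noteq> 0"
    using fps_nth_qfac_inf_0 by auto
  ultimately have "fps_to_fls (shelf_series k 0 i) / fps_to_fls qfac_inf = fps_to_fls (shelf_fps k 0 i)"
    by simp
  then show ?case
    using k 0 by (simp only: B_base_def shelf.simps B_base_product)
next
  case (Suc j)
  show ?case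
  proof (cases "i = 1")
    case True
    then show ?thesis
      using Suc.IH[of k] k by (simp add: shelf_fps_step_first[unfolded One_nat_def])
  next
    case False
    with Suc.prems have i: "i \<in> {2..k}"
      by auto
    define y where "y = qv ^ Suc j"
    define v where "v i = fps_to_fls (shelf_fps k j i)" for i
    have y: "1 + y \<noteq> 0" "y \<noteq> 0"
    proof -
      have "fps_nth (1 + fps_X ^ Suc j :: complex fps) 0 \<noteq> 0"
        by simp
      then have "1 + fps_X ^ Suc j \<noteq> (0 :: complex fps)"
        by (metis fps_zero_nth)
      moreover have "fps_to_fls (1 + fps_X ^ Suc j) = 1 + y"
        by (simp only: y_def fps_to_fls_plus fps_one_to_fls fps_to_fls_power fps_X_to_fls)
      ultimately show "1 + y \<noteq> 0"
        by (metis fps_to_fls_eq_0_iff)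
      show "y \<noteq> 0"
        by (simp add: y_def)
    qed
    \<comment> \<open>For \<open>i = 2\<close> this is the last ghost series, which fits the inner
      rule because position \<open>Suc k\<close> carries the value 0.\<close>
    have ghost: "ghost k j (shelf k j) (k - i + 2) = (v (k - i + 1) + y * v (k - i + 3)) / (1 + y)"
    proof (cases "i = 2")
      case True
      have "k - 1 \<in> {1..k}" "k - 2 + 2 = k" "k - 2 + 1 = k - 1" "k - 2 + 3 = Suc k"
        using k by auto
      with True show ?thesis
        by (simp add: ghost_def v_def y_def Suc.IH shelf_fps_beyond)
    next
      case False
      have "k - i + 2 \<noteq> k" "k - i + 2 - 1 = k - i + 1" "k - i + 2 + 1 = k - i + 3"
           "k - i + 1 \<in> {1..k}" "k - i + 3 \<in> {1..k}"
        using i False by auto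
      then show ?thesis
        unfolding ghost_def v_def y_def by (simp only: if_False Suc.IH Suc_eq_plus1)
    qed
    have "(1 + y) * y ^ (i - 2) * fps_to_fls (shelf_fps k (Suc j) i) = v (k - i + 1) - v (k - i + 3)"
      using arg_cong[OF shelf_fps_step[OF i, of j], of fps_to_fls]
      by (simp only: fls_times_fps_to_fls fps_to_fls_plus fps_to_fls_minus fps_one_to_fls
          fps_to_fls_power fps_X_to_fls v_def y_def power_mult)
    then have *: "y * (v (k - i + 1) - v (k - i + 3)) / (1 + y) = y ^ (i - 1) * fps_to_fls (shelf_fps k (Suc j) i)"
    proof -
      have "i - 1 = Suc (i - 2)"
        using i by auto
      then have "y ^ (i - 1) = y * y ^ (i - 2)"
        by (simp only: power_Suc)
      then show ?thesis
        using y \<open>_ = v (k - i + 1) - v (k - i + 3)\<close>[symmetric] by simp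
    qed
    have "k - i + 1 \<in> {1..k}"
      using i by auto
    then have "shelf k (Suc j) i = (v (k - i + 1) - (v (k - i + 1) + y * v (k - i + 3)) / (1 + y)) / y ^ (i - 1)"
      using False by (simp only: shelf.simps if_False ghost Suc.IH v_def[symmetric] Suc_eq_plus1[symmetric]
          power_mult y_def[symmetric])
    also have "v (k - i + 1) - (v (k - i + 1) + y * v (k - i + 3)) / (1 + y) = y * (v (k - i + 1) - v (k - i + 3)) / (1 + y)"
      using y by (simp add: field_simps)
    finally show ?thesis
      unfolding * using y by simp
  qed
qed

text \<open>For \<open>N \<ge> 1\<close> the exponent is at least \<open>1 + j\<close>, where
  \<open>k \<ge> 2\<close> yields the summand \<open>j\<close>. The term \<open>N = 0\<close>
  reduces to \<open>shelf_weight j 0\<close>, which agrees with the denominator.\<close>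

lemma fps_agree_shelf_fps:
  assumes k: "k \<ge> 2" and i: "i \<in> {1..k}"
  shows "fps_agree (Suc j) (shelf_fps k j i) 1"
proof (rule fps_agree_mult_cancel_right)
  show "fps_nth (shelf_denom j) 0 \<noteq> 0"
    by (simp add: fps_nth_shelf_denom_0)
  have "fps_agree (Suc j) (shelf_series k j i) (shelf_weight j 0 :: complex fps)"
  proof -
    have tail: "fps_agree (Suc j) (shelf_term k j i N) (0 :: complex fps)" if "N \<ge> 1" for N
    proof -
      have "1 + j * 1 \<le> k * N\<^sup>2 + (i - 1 + j * (k - 1)) * N"
      proof (rule add_mono)
        show "1 \<le> k * N\<^sup>2"
          using that k by (auto simp: Suc_le_eq)
        have "j * 1 * 1 \<le> (i - 1 + j * (k - 1)) * N"
          using that k by (intro mult_le_mono trans_le_add2) auto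
        then show "j * 1 \<le> (i - 1 + j * (k - 1)) * N"
          by simp
      qed
      then show ?thesis
        unfolding shelf_term_def by (intro fps_agree_dvd_0[OF _ order_refl] dvd_mult2 dvd_mult le_imp_power_dvd) auto
    qed
    have "fps_agree (Suc j) (shelf_series k j i) (\<Sum>N<Suc j. shelf_term k j i N :: complex fps)"
      unfolding shelf_series_def using k by (intro fps_agree_series X_power_dvd_shelf_term) auto
    also have "\<dots> = shelf_term k j i 0 + (\<Sum>N<j. shelf_term k j i (Suc N))"
      by (rule sum.lessThan_Suc_shift)
    also have "fps_agree (Suc j) \<dots> (shelf_weight j 0 * 1 + (\<Sum>N<j. 0))"
    proof (intro fps_agree_add fps_agree_sum tail)
      have "1 * Suc j \<le> (k + 1 - i) * (2 * 0 + j + 1)"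
        using i by (intro mult_le_mono) auto
      then have "Suc j \<le> (k + 1 - i) * (2 * 0 + j + 1)"
        by (simp only: mult_1)
      then have "fps_agree (Suc j) (shelf_weight j 0 * (1 - fps_X ^ ((k + 1 - i) * (2 * 0 + j + 1)))) (shelf_weight j 0 * (1 :: complex fps))"
        by (intro fps_agree_mult fps_agree_refl fps_agree_one_minus_X_power)
      then show "fps_agree (Suc j) (shelf_term k j i 0) (shelf_weight j 0 * (1 :: complex fps))"
        by (simp add: shelf_term_def)
    qed auto
    finally show ?thesis
      by simp
  qed
  also have "shelf_weight j 0 = (\<Prod>s<j. 1 - fps_X ^ Suc s) * (\<Prod>s<j. 1 + fps_X ^ Suc s :: complex fps)"
    unfolding shelf_weight_def prod.distrib[symmetric]
  proof (rule prod.cong[OF refl])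
    fix s
    have "1 - u * u = (1 - u) * (1 + u)" for u :: "complex fps"
      by (simp add: algebra_simps)
    then show "1 - fps_X ^ (2 * (0 + Suc s)) = (1 - fps_X ^ Suc s) * (1 + fps_X ^ Suc s :: complex fps)"
      by (simp only: add_0 mult_2 power_add)
  qed
  also have "fps_agree (Suc j) \<dots> (shelf_denom j)"
    unfolding shelf_denom_def by (intro fps_agree_mult fps_agree_refl fps_agree_sym[OF fps_agree_qfac_inf])
  finally show "fps_agree (Suc j) (shelf_fps k j i * shelf_denom j) (1 * shelf_denom j)"
    by (simp add: shelf_fps_mult_denom)
qed

section \<open>Expansion in a later shelf\<close>

definition complex_fps :: "int fps \<Rightarrow> complex fps" where
  "complex_fps f = Abs_fps (\<lambda>s. of_int (fps_nth f s))"

lemma fps_nth_complex_fps [simp]: "fps_nth (complex_fps f) s = of_int (fps_nth f s)"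
  by (simp add: complex_fps_def)

lemma complex_fps_0 [simp]: "complex_fps 0 = 0"
  by (rule fps_ext) simp

lemma complex_fps_1 [simp]: "complex_fps 1 = 1"
  by (rule fps_ext) simp

lemma complex_fps_add: "complex_fps (f + g) = complex_fps f + complex_fps g"
  by (rule fps_ext) simp

lemma complex_fps_mult: "complex_fps (f * g) = complex_fps f * complex_fps g"
  by (rule fps_ext) (simp add: fps_mult_nth)

lemma complex_fps_sum: "complex_fps (sum f A) = (\<Sum>x\<in>A. complex_fps (f x))"
  by (rule fps_ext) (simp add: fps_sum_nth)

lemma complex_fps_X_power: "complex_fps (fps_X ^ n) = fps_X ^ n"
  by (rule fps_ext) (simp add: fps_X_power_nth)

definition h_fps :: "nat \<Rightarrow> nat \<Rightarrow> nat \<Rightarrow> nat \<Rightarrow> nat \<Rightarrow> complex fps" where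
  "h_fps k J i j l = complex_fps (fps_of_poly (h k J i j l))"

lemma h_fps_init: "h_fps k J i J l = (if l = i then 1 else 0)"
  by (simp add: h_fps_def h_init)

lemma h_fps_step_1:
  assumes "J \<le> j"
  shows "h_fps k J i (Suc j) 1 = (\<Sum>t | t \<in> {1..k} \<and> [t = k] (mod 2). h_fps k J i j t)"
  using h_step_1[OF assms, of k i] by (simp add: h_fps_def fps_of_poly_sum complex_fps_sum)

lemma h_fps_step:
  assumes "J \<le> j" "l \<in> {2..k}"
  shows "h_fps k J i (Suc j) l = (1 + fps_X ^ Suc j) * fps_X ^ ((l - 2) * Suc j) *
           (\<Sum>t | t \<in> {1..k - l + 1} \<and> [t = l + k + 1] (mod 2). h_fps k J i j t)"
  using h_step[OF assms, of i] unfolding h_fps_def Suc_eq_plus1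
  by (simp add: fps_of_poly_sum fps_of_poly_mult fps_of_poly_add fps_of_poly_monom complex_fps_sum
      complex_fps_mult complex_fps_add complex_fps_X_power del: power_Suc h.simps)

text \<open>Positions are counted from the end, with \<open>d = 0\<close> the fictitious position
  \<open>k + 1\<close> and \<open>d = 1\<close> the overlap with the next shelf. The shelf relation
  links positions two apart, hence the induction in steps of two.\<close>

lemma shelf_fps_expand:
  assumes k: "k \<ge> 1" and d: "d \<le> k"
  shows "shelf_fps k j (k + 1 - d) = (if odd d then shelf_fps k (Suc j) 1 else 0) +
     (\<Sum>l | l \<in> {2..d} \<and> even (l + d). (1 + fps_X ^ Suc j) * fps_X ^ ((l - 2) * Suc j) * shelf_fps k (Suc j) l)"
    (is "_ = _ + sum ?w _")
  using d
proof (induction d rule: induct_nat_012)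
  case 0
  then show ?case
    by (simp add: shelf_fps_beyond)
next
  case 1
  then show ?case
    using shelf_fps_step_first[OF k, of j] by simp
next
  case (ge2 d)
  have "{l \<in> {2..Suc (Suc d)}. even (l + Suc (Suc d))} = insert (Suc (Suc d)) {l \<in> {2..d}. even (l + d)}"
    by (auto simp: le_Suc_eq)
  then have "(\<Sum>l | l \<in> {2..Suc (Suc d)} \<and> even (l + Suc (Suc d)). ?w l)
      = ?w (Suc (Suc d)) + (\<Sum>l | l \<in> {2..d} \<and> even (l + d). ?w l)"
    by simp
  moreover have "?w (Suc (Suc d)) = shelf_fps k j (k + 1 - Suc (Suc d)) - shelf_fps k j (k + 1 - d)"
  proof -
    have "k - Suc (Suc d) + 1 = k + 1 - Suc (Suc d)" "k - Suc (Suc d) + 3 = k + 1 - d"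
      using ge2.prems by auto
    then show ?thesis
      using shelf_fps_step[of "Suc (Suc d)" k j] ge2.prems by (simp add: mult.commute del: power_Suc)
  qed
  ultimately show ?case
    using ge2 by simp
qed

text \<open>Substituting the expansion of shelf \<open>j\<close> and exchanging the sums gives
  exactly the recursion for \<open>h\<close>: that recursion is the transpose of the
  expansion.\<close>

lemma shelf_fps_eq_sum_h:
  assumes i: "i \<in> {1..k}" and j: "J \<le> j"
  shows "shelf_fps k J i = (\<Sum>l\<in>{1..k}. h_fps k J i j l * shelf_fps k j l)"
  using j
proof (induction j rule: dec_induct)
  case base
  then show ?case
    using i by (simp add: h_fps_init if_distrib[of "\<lambda>x. x * _"] cong: if_cong)
next
  case (step j)
  have k: "k \<ge> 1"
    using i by auto
  define w where "w l = (1 + fps_X ^ Suc j) * fps_X ^ ((l - 2) * Suc j) * shelf_fps k (Suc j) l" for l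
  define H where "H t = h_fps k J i j t" for t
  \<comment> \<open>The expansion at \<open>d = k + 1 - t\<close>, with its parity conditions
    rewritten as the congruences in the definition of \<open>h\<close>.\<close>
  have expand: "shelf_fps k j t = (if [t = k] (mod 2) then shelf_fps k (Suc j) 1 else 0)
       + (\<Sum>l | l \<in> {2..k} \<and> l \<le> k - t + 1 \<and> [t = l + k + 1] (mod 2). w l)" if t: "t \<in> {1..k}" for t
  proof -
    have "{l. l \<in> {2..k + 1 - t} \<and> even (l + (k + 1 - t))} =
        {l. l \<in> {2..k} \<and> l \<le> k - t + 1 \<and> [t = l + k + 1] (mod 2)}"
      using t by (auto simp: cong_def mod_2_eq_odd)
    moreover have "odd (k + 1 - t) \<longleftrightarrow> [t = k] (mod 2)"
      using t by (auto simp: cong_def mod_2_eq_odd)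
    moreover have "k + 1 - (k + 1 - t) = t" "k + 1 - t \<le> k"
      using t by auto
    ultimately show ?thesis
      using shelf_fps_expand[OF k, of "k + 1 - t" j] by (simp only: w_def)
  qed
  have "shelf_fps k J i = (\<Sum>t\<in>{1..k}. H t * shelf_fps k j t)"
    using step.IH by (simp add: H_def)
  also have "\<dots> = (\<Sum>t\<in>{1..k}. if [t = k] (mod 2) then H t * shelf_fps k (Suc j) 1 else 0) +
      (\<Sum>t\<in>{1..k}. \<Sum>l | l \<in> {2..k} \<and> l \<le> k - t + 1 \<and> [t = l + k + 1] (mod 2). H t * w l)"
    unfolding sum.distrib[symmetric]
    by (rule sum.cong) (auto simp: expand distrib_left sum_distrib_left)
  also have "(\<Sum>t\<in>{1..k}. if [t = k] (mod 2) then H t * shelf_fps k (Suc j) 1 else 0)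
       = h_fps k J i (Suc j) 1 * shelf_fps k (Suc j) 1"
    unfolding h_fps_step_1[OF step.hyps(1)] sum_distrib_right H_def by (rule sum.inter_filter[symmetric]) simp
  also have "(\<Sum>t\<in>{1..k}. \<Sum>l | l \<in> {2..k} \<and> l \<le> k - t + 1 \<and> [t = l + k + 1] (mod 2). H t * w l)
       = (\<Sum>l\<in>{2..k}. \<Sum>t | t \<in> {1..k} \<and> l \<le> k - t + 1 \<and> [t = l + k + 1] (mod 2). H t * w l)"
    by (rule sum.swap_restrict) auto
  also have "\<dots> = (\<Sum>l\<in>{2..k}. h_fps k J i (Suc j) l * shelf_fps k (Suc j) l)"
  proof (rule sum.cong[OF refl])
    fix l assume l: "l \<in> {2..k}"
    have "{t. t \<in> {1..k} \<and> l \<le> k - t + 1 \<and> [t = l + k + 1] (mod 2)} =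
        {t. t \<in> {1..k - l + 1} \<and> [t = l + k + 1] (mod 2)}"
      using l by auto
    then show "(\<Sum>t | t \<in> {1..k} \<and> l \<le> k - t + 1 \<and> [t = l + k + 1] (mod 2). H t * w l)
        = h_fps k J i (Suc j) l * shelf_fps k (Suc j) l"
      using l step.hyps by (simp only: h_fps_step H_def[symmetric] w_def sum_distrib_left sum_distrib_right mult_ac)
  qed
  also have "h_fps k J i (Suc j) 1 * shelf_fps k (Suc j) 1 + \<dots>
      = (\<Sum>l\<in>{1..k}. h_fps k J i (Suc j) l * shelf_fps k (Suc j) l)"
    using k by (subst (2) sum.atLeast_Suc_atMost) (auto simp: numeral_2_eq_2)
  finally show ?case .
qed

text \<open>In both clauses of the recursion, position \<open>l\<close> receives only from positions
  congruent to \<open>l + k + 1\<close> modulo 2; for \<open>l = 1\<close> this is the class of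
  \<open>k\<close>. Starting from \<open>i\<close>, the occupied parity class thus moves by
  \<open>k + 1\<close> at each step.\<close>

lemma h_parity:
  "l \<in> {1..k} \<Longrightarrow> odd (l + i + (k + 1) * t) \<Longrightarrow> h k J i (J + t) l = 0"
proof (induction t arbitrary: l)
  case 0
  then show ?case
    by (auto simp: h_init)
next
  case (Suc t)
  show ?case
  proof (cases "l = 1")
    case True
    have "h k J i (J + t) t' = 0" if "t' \<in> {1..k}" "[t' = k] (mod 2)" for t'
      using that Suc.prems(2) True by (intro Suc.IH) (auto simp: cong_def mod_2_eq_odd split: if_splits)
    then show ?thesis
      using True by auto
  next
    case False
    have "h k J i (J + t) t' = 0" if "t' \<in> {1..k - l + 1}" "[t' = l + k + 1] (mod 2)" for t'
      using that Suc.prems by (intro Suc.IH) (auto simp: cong_def mod_2_eq_odd split: if_splits)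
    then have "(\<Sum>t' | t' \<in> {1..k - l + 1} \<and> [t' = l + k + 1] (mod 2). h k J i (J + t) t') = 0"
      by (intro sum.neutral) auto
    then show ?thesis
      using False by simp
  qed
qed

text \<open>For \<open>l \<ge> 3\<close> the last recursion step contributes a power of q of order
  at least \<open>j\<close>; \<open>J < j\<close> ensures that there was such a step.\<close>

lemma fps_agree_h_fps_0:
  assumes "J < j" "l \<in> {3..k}"
  shows "fps_agree j (h_fps k J i j l) 0"
proof -
  obtain j' where j: "j = Suc j'" "J \<le> j'"
    using assms(1) by (cases j) auto
  have "1 * j \<le> (l - 2) * Suc j'"
    unfolding j using assms(2) by (intro mult_le_mono) auto
  then show ?thesis
    using h_fps_step[of J j' l k i] assms(2) j
    by (auto intro!: fps_agree_dvd_0[of "(l - 2) * Suc j'"])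
qed

lemma fps_agree_shelf_fps_h_fps:
  assumes k: "k \<ge> 2" and i: "i \<in> {1..k}" and t: "t > 0"
  shows "fps_agree (J + t) (shelf_fps k J i) (h_fps k J i (J + t) (bar (i + (k + 1) * t)))"
proof -
  define b where "b = bar (i + (k + 1) * t)"
  have b: "b \<in> {1..k}" "b = 1 \<or> b = 2" "even (b + i + (k + 1) * t)"
    using k by (auto simp: b_def bar_def)
  have "shelf_fps k J i = (\<Sum>l\<in>{1..k}. h_fps k J i (J + t) l * shelf_fps k (J + t) l)"
    using i by (intro shelf_fps_eq_sum_h) auto
  also have "fps_agree (J + t) \<dots> (\<Sum>l\<in>{1..k}. if l = b then h_fps k J i (J + t) b else 0)"
  proof (rule fps_agree_sum)
    fix l assume l: "l \<in> {1..k}"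
    \<comment> \<open>If the first two cases fail, \<open>l\<close> and \<open>b\<close> are the two
      different elements of \<open>{1, 2}\<close>, so \<open>l\<close> has the wrong parity.\<close>
    consider "l = b" | "l \<ge> 3" | "odd (l + i + (k + 1) * t)"
    proof (cases "l = b \<or> l \<ge> 3")
      case False
      then have "l + b = 3"
        using l b by auto
      then have "odd (l + b)"
        by simp
      moreover have "odd (l + b) \<Longrightarrow> even (b + i + x) \<Longrightarrow> odd (l + i + x)" for x
        by presburger
      ultimately show ?thesis
        using that b by blast
    qed (use that in blast)
    then show "fps_agree (J + t) (h_fps k J i (J + t) l * shelf_fps k (J + t) l) (if l = b then h_fps k J i (J + t) b else 0)"
    proof cases
      case 1
      have "fps_agree (J + t) (h_fps k J i (J + t) l * shelf_fps k (J + t) l) (h_fps k J i (J + t) l * 1)"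
        using k l by (intro fps_agree_mult fps_agree_refl fps_agree_mono[OF fps_agree_shelf_fps]) auto
      with 1 show ?thesis
        by simp
    next
      case 2
      have "fps_agree (J + t) (h_fps k J i (J + t) l * shelf_fps k (J + t) l) (0 * shelf_fps k (J + t) l)"
        using 2 l t by (intro fps_agree_mult fps_agree_refl fps_agree_h_fps_0) auto
      with 2 b show ?thesis
        by auto
    next
      case 3
      then show ?thesis
        using b h_parity[OF l 3, of J] by (auto simp: h_fps_def)
    qed
  qed
  also have "\<dots> = h_fps k J i (J + t) b"
    using b by simp
  finally show ?thesis
    by (simp add: b_def)
qed

text \<open>The argument \<open>i + (k + 1) * t\<close> of \<open>bar\<close> follows the occupied
  parity class and so treats odd and even \<open>k\<close> at once.\<close>

lemma B_eq_limit_h: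
  assumes k: "k \<ge> 2" and i: "i \<in> {1..k}"
  shows "\<exists>L. has_coeff_limit (\<lambda>t. fps_of_poly (h k J i (J + t) (bar (i + (k + 1) * t)))) L \<and>
             B k ((k - 1) * J + i) = int_fps_to_fls L"
proof -
  define P where "P t = fps_of_poly (h k J i (J + t) (bar (i + (k + 1) * t)))" for t
  \<comment> \<open>At index \<open>Suc s\<close> the agreement with the series already covers
    degree \<open>s\<close>.\<close>
  define L where "L = Abs_fps (\<lambda>s. fps_nth (P (Suc s)) s)"
  have P: "fps_nth (shelf_fps k J i) s = of_int (fps_nth (P t) s)" if "s < t" for s t
    using fps_agree_shelf_fps_h_fps[OF assms, of t J] that
    by (auto simp: fps_agree_def h_fps_def P_def)
  \<comment> \<open>Both integers have the same image in the complex numbers, namely a coefficient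
    of the fixed series, and the embedding is injective.\<close>
  have "fps_nth (P t) s = fps_nth L s" if "t > s" for s t
    using P[of s t] P[of s "Suc s"] that by (simp add: L_def)
  then have "has_coeff_limit P L"
    unfolding has_coeff_limit_def eventually_sequentially by (meson Suc_le_eq)
  moreover have "shelf_fps k J i = Abs_fps (\<lambda>s. of_int (fps_nth L s))"
    by (rule fps_ext) (simp add: L_def P)
  then have "B k ((k - 1) * J + i) = int_fps_to_fls L"
    using B_shelf[OF assms] shelf_eq_shelf_fps[OF assms] by (simp add: int_fps_to_fls_def)
  ultimately show ?thesis
    unfolding P_def by blast
qed

theorem theorem6p3:
  fixes k J i :: nat
  assumes "k \<ge> 2" and "i \<in> {1..k}"
  shows "(odd k \<longrightarrow>
            (\<exists>h_inf :: int fps.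
               has_coeff_limit (\<lambda>t. fps_of_poly (h k J i (J + t) (bar i))) h_inf \<and>
               B k ((k - 1) * J + i) = int_fps_to_fls h_inf)) \<and>
         (even k \<longrightarrow>
            (\<exists>h_inf :: int fps.
               has_coeff_limit (\<lambda>t. fps_of_poly (h k J i (J + t) (bar ((J + t) - J + i)))) h_inf \<and>
               B k ((k - 1) * J + i) = int_fps_to_fls h_inf))"
proof -
  \<comment> \<open>\<open>bar\<close> depends only on parity: \<open>(k + 1) * t\<close> is even
    for odd \<open>k\<close> and has the parity of \<open>t\<close> for even
    \<open>k\<close>.\<close>
  have "bar (i + (k + 1) * t) = (if odd k then bar i else bar ((J + t) - J + i))" for t
    by (auto simp: bar_def)
  then show ?thesis
    using B_eq_limit_h[OF assms, of J] by (cases "odd k") (simp_all only: if_True if_False simp_thms)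
qed

end
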